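(* Let $c,N\in\mathbb{R}_{\ge1}$ and let $G=\bigoplus_{i=1}^n\bigoplus_{j=1}^{n_i}C_{p_i^{e_{ij}}}\in\Omega_c\cap\mathcal{S}_N$ be a finite abelian group with $k(G)=k^*(G)$, with $p_1<\cdots<p_n$ and $p_1^2<p_2$ if $n>1$, with $\max_{1\le j\le n_1}e_{1j}>1$, and with $p_1$ large enough so that $\frac{\log_2(cp_1)}{p_1}N\le\frac1cK_1^*(G)$. Let $C_{p_1}^{n_1}$ denote the subgroup $\{x\in G: p_1x=0\}$ of $G$. Then any UFIM $S$ over $G\setminus\{0\}$ with irreducible factorization $\bigsqcup_{i=1}^mI_i$ such that for all $1\le i\le m$ the factor $S(I_i)$ contains an element outside of $C_{p_1}^{n_1}$ satisfies $$k(S)\le K_1^*(G).$$ In particular, if $n=1$ (so $G=\bigoplus_{j=1}^{n_1}C_{p_1^{e_{1j}}}$ is a $p_1$-group), then $k(G)=k^*(G)$ holds automatically and $G\in\Omega_1$, so, taking $c=1$, whenever $G\in\mathcal{S}_N$, $\max_{1\le j\le n_1}e_{1j}>1$ and $\frac{\log_2p_1}{p_1}N\le K_1^*(G)$, the inequality $k(S)\le K_1^*(G)$ holds for every UFIM $S$ over $G\setminus\{0\}$ each of whose irreducible factors contains an element outside of $C_{p_1}^{n_1}$.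
   Context: Groups are finite abelian, written additively; $C_n$ is the cyclic group of order $n$. An indexed multiset $S=\{g_1,\ldots,g_\ell\}$ over a set $X\subseteq G$ is a finite (possibly empty) indexed family of elements of $X$; for $I\subseteq[\ell]$ put $S(I)=\{g_i : i\in I\}$, and submultisets of $S$ are the $S(I)$. Put $\sigma(S)=\sum_{g\in S}g$ (with multiplicity), $\sigma(\emptyset)=0$. $S$ is zero-sum if $\sigma(S)=0$; minimal zero-sum if $\sigma(S)=0$ and $\sigma(S')\ne0$ for every $\emptyset\subsetneq S'\subsetneq S$; zero-sum free if $\sigma(S')\neq0$ for every $\emptyset\subsetneq S'\subseteq S$. An irreducible factorization of $S$ over $G\setminus\{0\}$ is a partition $[\ell]=\bigsqcup_{i=1}^m I_i$ into nonempty sets with each $S(I_i)$ minimal zero-sum (the $S(I_i)$ are the irreducible factors); two factorizations are equivalent iff they are the same set of blocks $\{I_1,\ldots,I_m\}$. A unique factorization indexed multiset (UFIM) over $G\setminus\{0\}$ is a zero-sum indexed multiset over $G\setminus\{0\}$ with exactly one irreducible factorization up to equivalence. The cross number of $S$ is $k(S)=\sum_{g\in S}\frac1{\mathrm{ord}(g)}$ (with multiplicity; $k(\emptyset)=0$), and $k(G)=\max\{k(S): S\text{ is a zero-sum free indexed multiset over }G\setminus\{0\}\}$. For $G=\bigoplus_{i=1}^n\bigoplus_{j=1}^{n_i}C_{p_i^{e_{ij}}}$ with distinct primes $p_i$ and $e_{ij}\ge1$, put $K_1^*(G)=\sum_{i=1}^n\sum_{j=1}^{n_i}\frac{p_i^{e_{ij}}-1}{p_i^{e_{ij}}-p_i^{e_{ij}-1}}$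 and $k^*(G)=\sum_{i=1}^n\sum_{j=1}^{n_i}\frac{p_i^{e_{ij}}-1}{p_i^{e_{ij}}}$. $P^-(M)$ and $P^+(M)$ denote the smallest and largest prime divisors of $M$. $\Omega_c$ is the class of finite abelian groups $G$ with $P^+(|G|)\le c\cdot P^-(|G|)$, and $\mathcal{S}_N$ is the class of finite abelian groups $G=\bigoplus_{i=1}^n\bigoplus_{j=1}^{n_i}C_{p_i^{e_{ij}}}$ with $\sum_{i=1}^n\sum_{j=1}^{n_i}e_{ij}\le N$. *)

theory Defs
  imports
    Complex_Main
    "HOL-Library.Disjoint_Sets"
    "HOL-Computational_Algebra.Primes"
    "HOL-Algebra.Multiplicative_Group"
    "HOL-Algebra.Elementary_Groups"
    "HOL-Algebra.Product_Groups"
begin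

text \<open>
  Groups follow the multiplicative notation of HOL-Algebra: the neutral element \<open>\<one>\<^bsub>G\<^esub>\<close>
  is the additive \<open>0\<close> and \<open>finprod G\<close> is the additive sum \<open>\<sigma>\<close>.

  An indexed multiset \<open>{g\<^sub>1, \<dots>, g\<^sub>l}\<close> is a function \<open>g\<close> on the index set \<open>{1..l}\<close>; a submultiset
  \<open>S(I)\<close> is given by \<open>g\<close> together with \<open>I \<subseteq> {1..l}\<close>. Inclusions between submultisets are
  inclusions between their index sets.
\<close>

definition indexed_multiset_over :: "'a set \<Rightarrow> nat \<Rightarrow> (nat \<Rightarrow> 'a) \<Rightarrow> bool" where
  "indexed_multiset_over A l g \<longleftrightarrow> (\<forall>i\<in>{1..l}. g i \<in> A)"

definition zero_sum :: "('a, 'b) monoid_scheme \<Rightarrow> (nat \<Rightarrow> 'a) \<Rightarrow> nat set \<Rightarrow> bool" where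
  "zero_sum G g I \<longleftrightarrow> finprod G g I = \<one>\<^bsub>G\<^esub>"

definition minimal_zero_sum :: "('a, 'b) monoid_scheme \<Rightarrow> (nat \<Rightarrow> 'a) \<Rightarrow> nat set \<Rightarrow> bool" where
  "minimal_zero_sum G g I \<longleftrightarrow>
     zero_sum G g I \<and> (\<forall>J. J \<noteq> {} \<and> J \<subset> I \<longrightarrow> \<not> zero_sum G g J)"

definition zero_sum_free :: "('a, 'b) monoid_scheme \<Rightarrow> (nat \<Rightarrow> 'a) \<Rightarrow> nat set \<Rightarrow> bool" where
  "zero_sum_free G g I \<longleftrightarrow> (\<forall>J. J \<noteq> {} \<and> J \<subseteq> I \<longrightarrow> \<not> zero_sum G g J)"

text \<open>
  A factorization is represented by its set of blocks, so equivalence of factorizations is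
  equality. The predicate \<open>partition_on\<close> already requires the blocks to be nonempty.
\<close>

definition irreducible_factorization ::
    "('a, 'b) monoid_scheme \<Rightarrow> nat \<Rightarrow> (nat \<Rightarrow> 'a) \<Rightarrow> nat set set \<Rightarrow> bool" where
  "irreducible_factorization G l g P \<longleftrightarrow>
     partition_on {1..l} P \<and> (\<forall>I\<in>P. minimal_zero_sum G g I)"

definition UFIM :: "('a, 'b) monoid_scheme \<Rightarrow> nat \<Rightarrow> (nat \<Rightarrow> 'a) \<Rightarrow> bool" where
  "UFIM G l g \<longleftrightarrow>
     indexed_multiset_over (carrier G - {\<one>\<^bsub>G\<^esub>}) l g \<and>
     zero_sum G g {1..l} \<and>
     (\<exists>!P. irreducible_factorization G l g P)"

definition cross_number :: "('a, 'b) monoid_scheme \<Rightarrow> (nat \<Rightarrow> 'a) \<Rightarrow> nat set \<Rightarrow> real" where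
  "cross_number G g I = (\<Sum>i\<in>I. 1 / real (group.ord G (g i)))"

text \<open>
  For a finite group, zero-sum free multisets have fewer elements than the group, so the
  maximum is taken over a finite set; it contains \<open>0\<close> because of the empty multiset.
\<close>

definition group_cross_number :: "('a, 'b) monoid_scheme \<Rightarrow> real" where
  "group_cross_number G =
     Max {cross_number G g {1..l} | l g.
            indexed_multiset_over (carrier G - {\<one>\<^bsub>G\<^esub>}) l g \<and> zero_sum_free G g {1..l}}"

definition primary_decomposition ::
    "('a, 'b) monoid_scheme \<Rightarrow> nat \<Rightarrow> (nat \<Rightarrow> nat) \<Rightarrow> (nat \<Rightarrow> nat) \<Rightarrow> (nat \<Rightarrow> nat \<Rightarrow> nat) \<Rightarrow> bool" where
  "primary_decomposition G n r p e \<longleftrightarrow>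
     comm_group G \<and> finite (carrier G) \<and>
     (\<forall>i\<in>{1..n}. prime (p i)) \<and> inj_on p {1..n} \<and>
     (\<forall>i\<in>{1..n}. 1 \<le> r i \<and> (\<forall>j\<in>{1..r i}. 1 \<le> e i j)) \<and>
     G \<cong> product_group (SIGMA i:{1..n}. {1..r i}) (\<lambda>(i, j). integer_mod_group (p i ^ e i j))"

text \<open>
  The quantities \<open>K\<^sub>1\<^sup>*(G)\<close> and \<open>k\<^sup>*(G)\<close> are expressed through the data of a decomposition of \<open>G\<close>
  into cyclic groups of prime power order.
\<close>

definition K1_star :: "nat \<Rightarrow> (nat \<Rightarrow> nat) \<Rightarrow> (nat \<Rightarrow> nat) \<Rightarrow> (nat \<Rightarrow> nat \<Rightarrow> nat) \<Rightarrow> real" where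
  "K1_star n r p e =
     (\<Sum>i=1..n. \<Sum>j=1..r i.
        (real (p i) ^ e i j - 1) / (real (p i) ^ e i j - real (p i) ^ (e i j - 1)))"

definition k_star :: "nat \<Rightarrow> (nat \<Rightarrow> nat) \<Rightarrow> (nat \<Rightarrow> nat) \<Rightarrow> (nat \<Rightarrow> nat \<Rightarrow> nat) \<Rightarrow> real" where
  "k_star n r p e = (\<Sum>i=1..n. \<Sum>j=1..r i. (real (p i) ^ e i j - 1) / real (p i) ^ e i j)"

definition P_minus :: "nat \<Rightarrow> nat" where
  "P_minus M = Min (prime_factors M)"

definition P_plus :: "nat \<Rightarrow> nat" where
  "P_plus M = Max (prime_factors M)"

definition in_Omega :: "real \<Rightarrow> ('a, 'b) monoid_scheme \<Rightarrow> bool" where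
  "in_Omega c G \<longleftrightarrow>
     comm_group G \<and> finite (carrier G) \<and>
     real (P_plus (order G)) \<le> c * real (P_minus (order G))"

definition in_S :: "real \<Rightarrow> ('a, 'b) monoid_scheme \<Rightarrow> bool" where
  "in_S N G \<longleftrightarrow>
     (\<exists>n r p e. primary_decomposition G n r p e \<and>
        real (\<Sum>i=1..n. \<Sum>j=1..r i. e i j) \<le> N)"

definition torsion_part :: "('a, 'b) monoid_scheme \<Rightarrow> nat \<Rightarrow> 'a set" where
  "torsion_part G q = {x \<in> carrier G. x [^]\<^bsub>G\<^esub> q = \<one>\<^bsub>G\<^esub>}"

end

theory Submission
  imports Defs "HOL-Library.Poly_Mapping" "HOL-Library.Function_Algebras"
begin

text \<open>
  Uniqueness of the factorization forces every zero-sum submultiset of \<open>S\<close> to be a union of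
  blocks. Deleting one element \<open>x\<^sub>I \<notin> C\<^bsub>p\<^sub>1\<^esub>\<^bsup>n\<^sub>1\<^esup>\<close> from each block \<open>I\<close> therefore leaves a
  zero-sum free multiset, of cross number at most \<open>k(G) = k\<^sup>*(G)\<close>. Each deleted element has
  order at least \<open>p\<^sub>1\<^sup>2\<close>, and the subset sums of the deleted elements are pairwise distinct, so
  there are at most \<open>log\<^sub>2 |G| \<le> N log\<^sub>2 (c p\<^sub>1)\<close> of them. The resulting error term is at most
  \<open>K\<^sub>1\<^sup>*(G) / (c p\<^sub>1)\<close>, which the gap \<open>K\<^sub>1\<^sup>*(G) - k\<^sup>*(G)\<close> absorbs because all primes are at most
  \<open>c p\<^sub>1\<close>.

  The identity \<open>k(G) = k\<^sup>*(G)\<close> for a \<open>p\<close>-group is a weighted form of Olson's group ring argument.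
  If \<open>f\<^sub>j\<close> generates the summand of order \<open>p\<^bsup>e\<^sub>j\<^esup>\<close> and \<open>p\<^sup>E\<close> annihilates \<open>G\<close>, give \<open>f\<^sub>j - 1\<close> the
  weight \<open>p\<^bsup>E - e\<^sub>j\<^esup>\<close>. By Frobenius \<open>g - 1\<close> has weight at least \<open>p\<^sup>E / ord(g)\<close> modulo \<open>p\<close>, while
  monomials of weight above \<open>p\<^sup>E k\<^sup>*(G)\<close> vanish. If the cross number of a sequence exceeds \<open>k\<^sup>*(G)\<close>,
  then \<open>\<Prod> (g\<^sub>i - 1)\<close> is zero modulo \<open>p\<close>, and the coefficient at the neutral element exhibits a
  nonempty zero-sum subsequence.
\<close>

section \<open>Frobenius congruences modulo a prime in commutative rings\<close>

text \<open>The inner binomial coefficients are multiples of \<open>p\<close>. The characteristic of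
  the ring is arbitrary, so the multiple of \<open>p\<close> stays explicit.\<close>

lemma prime_power_sum_cong:
  fixes y :: "'a::comm_ring_1"
  assumes "prime p"
  shows "\<exists>c. (y + 1) ^ p = y ^ p + 1 + of_nat p * c"
proof -
  have "p \<ge> 2" using assms prime_ge_2_nat by blast
  have "(y + 1) ^ p = (\<Sum>k\<le>p. of_nat (p choose k) * y ^ k)"
    by (simp add: binomial_ring)
  also have "{..p} = insert 0 (insert p {1..<p})" using \<open>p \<ge> 2\<close> by auto
  also have "(\<Sum>k\<in>\<dots>. of_nat (p choose k) * y ^ k) =
      y ^ p + 1 + (\<Sum>k\<in>{1..<p}. of_nat (p choose k) * y ^ k)"
    using \<open>p \<ge> 2\<close> by simp
  also have "(\<Sum>k\<in>{1..<p}. of_nat (p choose k) * y ^ k) =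
      (\<Sum>k\<in>{1..<p}. of_nat p * (of_nat ((p choose k) div p) * y ^ k))"
  proof (rule sum.cong[OF refl])
    fix k assume "k \<in> {1..<p}"
    then have "p dvd (p choose k)" using assms by (intro dvd_choose_prime) auto
    then have "p choose k = p * ((p choose k) div p)" by simp
    then have "(of_nat (p choose k) :: 'a) = of_nat p * of_nat ((p choose k) div p)"
      by (metis of_nat_mult)
    then show "of_nat (p choose k) * y ^ k = of_nat p * (of_nat ((p choose k) div p) * y ^ k)"
      by (simp add: mult.assoc)
  qed
  also have "\<dots> = of_nat p * (\<Sum>k\<in>{1..<p}. of_nat ((p choose k) div p) * y ^ k)"
    by (simp add: sum_distrib_left)
  finally show ?thesis by blast
qed

text \<open>Each induction step raises the previous congruence to the \<open>p\<close>-th power.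
  Expanding \<open>(y + 1) ^ p\<close> with \<open>y = x ^ (p ^ k) - 1\<close>, instead of
  \<open>(x - 1) ^ p\<close>, avoids the sign \<open>(- 1) ^ p\<close> and with it a separate case
  \<open>p = 2\<close>.\<close>

lemma frobenius_minus_1:
  fixes x :: "'a::comm_ring_1"
  assumes "prime p"
  shows "\<exists>c. (x - 1) ^ (p ^ k) = x ^ (p ^ k) - 1 + of_nat p * c"
proof (induction k)
  case 0
  then show ?case by (auto intro: exI[of _ 0])
next
  case (Suc k)
  then obtain c where c: "(x - 1) ^ (p ^ k) = x ^ (p ^ k) - 1 + of_nat p * c" by blast
  define y where "y = x ^ (p ^ k) - 1"
  \<comment> \<open>Congruent elements have congruent powers: the difference of the bases divides
    the difference of the powers.\<close>
  have "\<exists>d. (y + of_nat p * c) ^ p = y ^ p + of_nat p * d"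
  proof -
    have "of_nat p * c dvd (y + of_nat p * c) ^ p - y ^ p"
      using power_diff_sumr2[of "y + of_nat p * c" p y] by simp
    then obtain d where "(y + of_nat p * c) ^ p - y ^ p = of_nat p * c * d" by (elim dvdE)
    then have "(y + of_nat p * c) ^ p = y ^ p + of_nat p * (c * d)"
      by (simp add: algebra_simps)
    then show ?thesis by blast
  qed
  then obtain d where d: "(y + of_nat p * c) ^ p = y ^ p + of_nat p * d" by blast
  obtain b where b: "(y + 1) ^ p = y ^ p + 1 + of_nat p * b"
    using prime_power_sum_cong[OF assms] by blast
  have "(x - 1) ^ (p ^ Suc k) = (y + of_nat p * c) ^ p"
    by (metis c y_def power_Suc2 power_mult)
  also have "\<dots> = (y + 1) ^ p - 1 + of_nat p * (d - b)"
    using b d by (simp add: algebra_simps)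
  also have "(y + 1) ^ p = x ^ (p ^ Suc k)"
    by (simp add: y_def power_mult[symmetric] mult.commute)
  finally show ?case by blast
qed

section \<open>Weight filtration of a ring modulo an ideal\<close>

text \<open>This becomes the ideal generated by \<open>Z\<close> and the monomials in
  \<open>X\<close> of weight at least \<open>s\<close>. Having \<open>Z\<close> inside every level
  replaces computation in the quotient ring by membership.\<close>

inductive_set weight_ideal :: "'a::comm_ring_1 set \<Rightarrow> 'i set \<Rightarrow> ('i \<Rightarrow> 'a) \<Rightarrow> ('i \<Rightarrow> nat) \<Rightarrow> nat \<Rightarrow> 'a set"
  for Z I X w s where
  base: "z \<in> Z \<Longrightarrow> z \<in> weight_ideal Z I X w s"
| monom: "s \<le> (\<Sum>j\<in>I. k j * w j) \<Longrightarrow> c * (\<Prod>j\<in>I. X j ^ k j) \<in> weight_ideal Z I X w s"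
| add: "x \<in> weight_ideal Z I X w s \<Longrightarrow> y \<in> weight_ideal Z I X w s \<Longrightarrow> x + y \<in> weight_ideal Z I X w s"

text \<open>\<open>Z\<close> is an ideal modulo which \<open>p\<close> vanishes and each
  \<open>X j\<close> is nilpotent. In the application it is the kernel of the map to the group ring
  modulo \<open>p\<close>, with \<open>X j\<close> mapping to \<open>f_j - 1\<close> for a generator
  \<open>f_j\<close> of the \<open>j\<close>-th summand.\<close>

locale weight_filtration =
  fixes Z :: "'a::comm_ring_1 set" and I :: "'i set" and X :: "'i \<Rightarrow> 'a" and w :: "'i \<Rightarrow> nat"
    and p :: nat and e :: "'i \<Rightarrow> nat"
  assumes finI: "finite I" and prime: "prime p"
    and Z_add: "x \<in> Z \<Longrightarrow> y \<in> Z \<Longrightarrow> x + y \<in> Z"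
    and Z_mult: "x \<in> Z \<Longrightarrow> c * x \<in> Z"
    and Z_p: "of_nat p \<in> Z"
    and Z_X: "j \<in> I \<Longrightarrow> X j ^ (p ^ e j) \<in> Z"
begin

abbreviation F where "F \<equiv> weight_ideal Z I X w"

lemma F_mult_left: "x \<in> F s \<Longrightarrow> c * x \<in> F s"
proof (induction rule: weight_ideal.induct)
  case (base z) then show ?case by (intro weight_ideal.base Z_mult)
next
  case (monom k d)
  then show ?case using weight_ideal.monom[OF monom, of "c * d"] by (simp add: mult.assoc)
next
  case (add x y) then show ?case by (simp add: distrib_left weight_ideal.add)
qed

lemma F_mult: "x \<in> F s \<Longrightarrow> y \<in> F t \<Longrightarrow> x * y \<in> F (s + t)"
proof (induction rule: weight_ideal.induct)
  case (base z)
  then show ?case using Z_mult[of z y] by (simp add: weight_ideal.base mult.commute)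
next
  case (monom k c)
  note k = monom(1)
  from monom(2) show ?case
  proof (induction rule: weight_ideal.induct)
    case (base z)
    then show ?case using Z_mult by (simp add: weight_ideal.base)
  next
    case (monom h d)
    have "s + t \<le> (\<Sum>j\<in>I. (k j + h j) * w j)"
      using k monom by (simp add: distrib_right sum.distrib)
    from weight_ideal.monom[OF this, where c="c * d"] show ?case
      by (simp add: power_add prod.distrib mult.assoc mult.left_commute)
  next
    case (add x y)
    then show ?case by (simp add: distrib_left weight_ideal.add)
  qed
next
  case (add x y)
  then show ?case by (simp add: distrib_right weight_ideal.add)
qed

lemma F_zero: "x \<in> F 0"
  using weight_ideal.monom[of 0 "\<lambda>_. 0" w I x] by simp

lemma F_prod: "finite A \<Longrightarrow> (\<And>i. i \<in> A \<Longrightarrow> x i \<in> F (s i)) \<Longrightarrow> (\<Prod>i\<in>A. x i) \<in> F (\<Sum>i\<in>A. s i)"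
  by (induction A rule: finite_induct) (auto simp: F_zero F_mult)

text \<open>The elements congruent to 1 modulo an ideal are closed under products, by
  \<open>x * y - 1 = x * (y - 1) + (x - 1)\<close>.\<close>

lemma F_prod_minus_1:
  "finite A \<Longrightarrow> (\<And>i. i \<in> A \<Longrightarrow> x i - 1 \<in> F s) \<Longrightarrow> (\<Prod>i\<in>A. x i) - 1 \<in> F s"
proof (induction A rule: finite_induct)
  case empty
  then show ?case using F_mult_left[of _ s 0] weight_ideal.base Z_mult[OF Z_p, of 0] by auto
next
  case (insert a A)
  have "(\<Prod>i\<in>insert a A. x i) - 1 = x a * ((\<Prod>i\<in>A. x i) - 1) + (x a - 1)"
    using insert by (simp add: algebra_simps)
  moreover have "x a * ((\<Prod>i\<in>A. x i) - 1) + (x a - 1) \<in> F s"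
    using insert by (intro weight_ideal.add F_mult_left) auto
  ultimately show ?case by (simp only:)
qed

lemma F_power_X:
  assumes "j \<in> I" "s \<le> k * w j"
  shows "X j ^ k \<in> F s"
proof -
  have "(\<Prod>i\<in>I. X i ^ (if i = j then k else 0)) = X j ^ k"
    using assms finI by (simp add: if_distrib prod.delta cong: if_cong)
  moreover have "(\<Sum>i\<in>I. (if i = j then k else 0) * w i) = k * w j"
    using assms finI by (simp add: if_distrib[of "\<lambda>x. x * _"] sum.delta cong: if_cong)
  ultimately show ?thesis
    using weight_ideal.monom[of s "\<lambda>i. if i = j then k else 0" w I 1 X Z] assms by simp
qed

text \<open>Pigeonhole: a monomial of weight beyond the bound cannot have all exponents below
  \<open>p ^ e j\<close>, so it contains a factor \<open>X j ^ (p ^ e j)\<close>, which lies in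
  \<open>Z\<close>.\<close>

lemma F_subset_Z:
  assumes "s > (\<Sum>j\<in>I. (p ^ e j - 1) * w j)" "x \<in> F s"
  shows "x \<in> Z"
  using assms(2)
proof (induction rule: weight_ideal.induct)
  case (monom k c)
  have "\<exists>j\<in>I. p ^ e j \<le> k j"
  proof (rule ccontr)
    assume "\<not> ?thesis"
    then have "(\<Sum>j\<in>I. k j * w j) \<le> (\<Sum>j\<in>I. (p ^ e j - 1) * w j)"
      by (intro sum_mono mult_right_mono) (auto simp: not_le)
    then show False using monom assms(1) by simp
  qed
  then obtain j where j: "j \<in> I" "p ^ e j \<le> k j" by blast
  have "(\<Prod>j\<in>I. X j ^ k j) = X j ^ k j * (\<Prod>j\<in>I - {j}. X j ^ k j)"
    using finI j(1) by (rule prod.remove)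
  also have "X j ^ k j = X j ^ (k j - p ^ e j) * X j ^ (p ^ e j)"
    using j by (simp flip: power_add)
  finally have "c * (\<Prod>j\<in>I. X j ^ k j) =
      c * X j ^ (k j - p ^ e j) * (\<Prod>j\<in>I - {j}. X j ^ k j) * X j ^ (p ^ e j)"
    by (simp add: mult_ac)
  then show ?case using Z_mult[OF Z_X[OF j(1)]] by simp
qed (auto intro: Z_add)

text \<open>Frobenius gives \<open>(1 + X j) ^ (p ^ v) - 1\<close> the weight of
  \<open>X j ^ (p ^ v)\<close> modulo \<open>p\<close>, and a geometric sum shows that this element
  divides \<open>(1 + X j) ^ a - 1\<close>.\<close>

lemma F_one_plus_X_power:
  assumes j: "j \<in> I" and "p ^ v dvd a" "s \<le> p ^ v * w j"
  shows "(1 + X j) ^ a - 1 \<in> F s"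
proof -
  obtain b where b: "a = p ^ v * b" using assms by blast
  obtain c where c: "(1 + X j - 1) ^ (p ^ v) = (1 + X j) ^ (p ^ v) - 1 + of_nat p * c"
    using frobenius_minus_1[OF prime] by blast
  have "(1 + X j) ^ (p ^ v) - 1 = X j ^ (p ^ v) + (- c) * of_nat p"
    using c by (simp add: algebra_simps)
  then have *: "(1 + X j) ^ (p ^ v) - 1 \<in> F s"
    using F_power_X[OF j assms(3)] Z_mult[OF Z_p] by (metis weight_ideal.add weight_ideal.base)
  have "(1 + X j) ^ a - 1 = (\<Sum>i<b. ((1 + X j) ^ (p ^ v)) ^ i) * ((1 + X j) ^ (p ^ v) - 1)"
    using power_diff_1_eq[of "(1 + X j) ^ (p ^ v)" b] 
    by (simp only: b power_mult mult.commute[of "_ - 1"])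
  then show ?thesis using F_mult_left[OF *] by simp
qed

end


section \<open>Monomials as exponent vectors and the coefficient at the neutral element\<close>

lemma poly_mapping_add_induct:
  assumes single: "\<And>a b. P (Poly_Mapping.single a b)"
    and add: "\<And>f g. P f \<Longrightarrow> P g \<Longrightarrow> P (f + g)"
  shows "P (f :: 'a \<Rightarrow>\<^sub>0 'b::comm_monoid_add)"
proof (induction f rule: Poly_Mapping.update_induct)
  case const
  then show ?case using single[of _ 0] by simp
next
  case (update f a b)
  have "Poly_Mapping.update a b f = f + Poly_Mapping.single a b"
    using update(1)
    by (intro poly_mapping_eqI) (auto simp: lookup_update lookup_add lookup_single in_keys_iff)
  then show ?case using add single update by simp
qed

text \<open>
  Exponent vectors represent the elements of \<open>G\<close>. With \<open>D\<close> the set of vectors representing the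
  neutral element, this is the coefficient at the neutral element of the image in the group ring.
\<close>

definition coeff_sum :: "'a set \<Rightarrow> ('a \<Rightarrow>\<^sub>0 int) \<Rightarrow> int" where
  "coeff_sum D q = (\<Sum>x\<in>Poly_Mapping.keys q \<inter> D. Poly_Mapping.lookup q x)"

text \<open>Keys may cancel in a sum, so additivity has to be read off over a common finite index
  set.\<close>

lemma coeff_sum_superset:
  assumes "finite S" "Poly_Mapping.keys q \<subseteq> S"
  shows "coeff_sum D q = (\<Sum>x\<in>S \<inter> D. Poly_Mapping.lookup q x)"
  unfolding coeff_sum_def using assms
  by (intro sum.mono_neutral_left) (auto simp: in_keys_iff)

lemma coeff_sum_add: "coeff_sum D (q + q') = coeff_sum D q + coeff_sum D q'"
proof -
  define S where "S = Poly_Mapping.keys q \<union> Poly_Mapping.keys q'"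
  have "finite S" "Poly_Mapping.keys (q + q') \<subseteq> S" "Poly_Mapping.keys q \<subseteq> S"
    "Poly_Mapping.keys q' \<subseteq> S"
    using Poly_Mapping.keys_add[of q q'] by (auto simp: S_def)
  then show ?thesis by (simp add: coeff_sum_superset[of S] lookup_add sum.distrib)
qed

lemma coeff_sum_0 [simp]: "coeff_sum D 0 = 0"
  by (simp add: coeff_sum_def)

lemma coeff_sum_single: "coeff_sum D (Poly_Mapping.single x c) = (if x \<in> D then c else 0)"
  by (auto simp: coeff_sum_superset[of "{x}"])

lemma coeff_sum_uminus: "coeff_sum D (- q) = - coeff_sum D q"
  using coeff_sum_add[of D q "- q"] by simp

lemma coeff_sum_diff: "coeff_sum D (q - q') = coeff_sum D q - coeff_sum D q'"
  using coeff_sum_add[of D q "- q'"] by (simp add: coeff_sum_uminus)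

lemma coeff_sum_sum: "coeff_sum D (\<Sum>x\<in>A. f x) = (\<Sum>x\<in>A. coeff_sum D (f x))"
  by (induction A rule: infinite_finite_induct) (auto simp: coeff_sum_add)

lemma coeff_sum_of_nat_mult:
  fixes q :: "'a::comm_monoid_add \<Rightarrow>\<^sub>0 int"
  shows "coeff_sum D (q * of_nat n) = int n * coeff_sum D q"
  by (induction n) (auto simp: coeff_sum_add distrib_left distrib_right)

lemma coeff_sum_mult_minus_1_power:
  fixes q :: "'a::comm_monoid_add \<Rightarrow>\<^sub>0 int"
  shows "coeff_sum D (q * (- 1) ^ n) = (- 1) ^ n * coeff_sum D q"
  by (induction n) (auto simp: coeff_sum_uminus)

text \<open>The hypothesis holds when \<open>y\<close> represents the neutral element; the factor is
  then 1 in the group ring. Additivity reduces the claim to a single monomial.\<close>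

lemma coeff_sum_shift:
  fixes q :: "'a::comm_monoid_add \<Rightarrow>\<^sub>0 int"
  assumes "\<And>x. x + y \<in> D \<longleftrightarrow> x \<in> D"
  shows "coeff_sum D (q * Poly_Mapping.single y 1) = coeff_sum D q"
  by (induction q rule: poly_mapping_add_induct)
    (simp_all add: mult_single coeff_sum_single assms distrib_right coeff_sum_add)

lemma prod_single_1:
  "(\<Prod>j\<in>A. Poly_Mapping.single (f j) (1::'b::comm_semiring_1)) =
     Poly_Mapping.single (\<Sum>j\<in>A. f j) 1"
  by (induction A rule: infinite_finite_induct) (auto simp: mult_single)

lemma sum_fun_apply: "(\<Sum>i\<in>A. f i) x = (\<Sum>i\<in>A. f i x)"
  for f :: "'b \<Rightarrow> 'c \<Rightarrow> 'd::comm_monoid_add"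
  by (induction A rule: infinite_finite_induct) auto

lemma power_single_1:
  "Poly_Mapping.single f (1::'b::comm_semiring_1) ^ n =
     Poly_Mapping.single (\<lambda>x. n * f x) 1" for f :: "'i \<Rightarrow> nat"
proof -
  have "Poly_Mapping.single f (1::'b) ^ n = Poly_Mapping.single (\<Sum>_<n. f) 1"
    using prod_single_1[of "\<lambda>_. f" "{..<n}"] by (simp only: prod_constant card_lessThan)
  also have "(\<Sum>_<n. f) = (\<lambda>x. n * f x)"
    by (rule ext) (simp add: sum_fun_apply)
  finally show ?thesis .
qed

section \<open>The weighted group ring argument for zero-sum subsequences\<close>

text \<open>\<open>\<kappa> i\<close> stands for the exponent of the order of the
  \<open>i\<close>-th element, and the factor \<open>p ^ E\<close> clears denominators, so that
  \<open>large\<close> compares cross numbers. Without a zero-sum \<open>J\<close> the product of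
  the \<open>g_i - 1\<close> has coefficient 1 or -1 at the neutral element, although its weight
  puts it into \<open>Z\<close>.\<close>

theorem ex_zero_sum_weighted:
  fixes a :: "'k \<Rightarrow> 'i \<Rightarrow> nat" and e :: "'i \<Rightarrow> nat"
  assumes finI: "finite I" and prime: "prime p" and finL: "finite L"
    and eE: "\<And>j. j \<in> I \<Longrightarrow> e j \<le> E" and \<kappa>E: "\<And>i. i \<in> L \<Longrightarrow> \<kappa> i \<le> E"
    and ann: "\<And>i j. i \<in> L \<Longrightarrow> j \<in> I \<Longrightarrow> p ^ e j dvd p ^ \<kappa> i * a i j"
    and large: "(\<Sum>j\<in>I. (p ^ e j - 1) * p ^ (E - e j)) < (\<Sum>i\<in>L. p ^ (E - \<kappa> i))"
  shows "\<exists>J\<subseteq>L. J \<noteq> {} \<and> (\<forall>j\<in>I. p ^ e j dvd (\<Sum>i\<in>J. a i j))"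
proof (rule ccontr)
  assume contra: "\<not> ?thesis"
  define D :: "('i \<Rightarrow> nat) set" where "D = {x. \<forall>j\<in>I. p ^ e j dvd x j}"
  \<comment> \<open>Quantifying over all multipliers \<open>m\<close> yields the largest ideal on
    which the coefficient at the neutral element is divisible by \<open>p\<close>.\<close>
  define Z where "Z = {q. \<forall>m. int p dvd coeff_sum D (m * q)}"
  define unit :: "'i \<Rightarrow> 'i \<Rightarrow> nat" where "unit j = (\<lambda>k. of_bool (k = j))" for j
  define X :: "'i \<Rightarrow> ('i \<Rightarrow> nat) \<Rightarrow>\<^sub>0 int" where "X j = Poly_Mapping.single (unit j) 1 - 1" for j
  define w where "w j = p ^ (E - e j)" for j
  have Zp: "of_nat p \<in> Z" by (simp add: Z_def coeff_sum_of_nat_mult)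
  have Zadd: "x + y \<in> Z" if "x \<in> Z" "y \<in> Z" for x y
    using that by (auto simp: Z_def distrib_left coeff_sum_add)
  have Zmult: "c * x \<in> Z" if "x \<in> Z" for c x
    using that by (auto simp: Z_def mult.assoc[symmetric])
  have ZX: "X j ^ (p ^ e j) \<in> Z" if "j \<in> I" for j
  proof -
    obtain c where c: "X j ^ (p ^ e j) =
        Poly_Mapping.single (unit j) 1 ^ (p ^ e j) - 1 + of_nat p * c"
      using frobenius_minus_1[OF prime, of "Poly_Mapping.single (unit j) 1" "e j"]
      by (auto simp: X_def)
    \<comment> \<open>The exponent vector \<open>p ^ e j\<close> times \<open>unit j\<close>
      represents the neutral element, so translation by it preserves \<open>D\<close>.\<close>
    have "Poly_Mapping.single (unit j) (1::int) ^ (p ^ e j) - 1 \<in> Z"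
      by (simp add: Z_def power_single_1 right_diff_distrib coeff_sum_diff coeff_sum_shift
          D_def unit_def dvd_add_left_iff)
    moreover have "of_nat p * c \<in> Z" using Zmult[OF Zp] by (simp add: mult.commute)
    ultimately show ?thesis unfolding c by (rule Zadd)
  qed
  interpret weight_filtration Z I X w p e
    by unfold_locales (use finI prime Zadd Zmult Zp ZX in auto)
  \<comment> \<open>Exponent vectors are total functions, so the coordinates are extended by 0
    outside \<open>I\<close>.\<close>
  define y where "y i = (\<lambda>j. if j \<in> I then a i j else 0)" for i
  have prod_y: "(\<Prod>j\<in>I. (1 + X j) ^ a i j) = Poly_Mapping.single (y i) 1" for i
  proof -
    have "(\<Prod>j\<in>I. (1 + X j) ^ a i j) = Poly_Mapping.single (\<Sum>j\<in>I. (\<lambda>x. a i j * unit j x)) 1"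
      by (simp add: X_def power_single_1 prod_single_1)
    also have "(\<Sum>j\<in>I. (\<lambda>x. a i j * unit j x)) = y i"
      using finI by (intro ext) (simp add: sum_fun_apply unit_def y_def if_distrib of_bool_def cong: if_cong)
    finally show ?thesis .
  qed
  have "Poly_Mapping.single (y i) 1 - 1 \<in> F (p ^ (E - \<kappa> i))" if i: "i \<in> L" for i
    unfolding prod_y[symmetric]
  proof (rule F_prod_minus_1[OF finI])
    fix j assume j: "j \<in> I"
    have p0: "p > 0" using prime by (simp add: prime_gt_0_nat)
    show "(1 + X j) ^ a i j - 1 \<in> F (p ^ (E - \<kappa> i))"
    proof (rule F_one_plus_X_power[OF j])
      \<comment> \<open>For \<open>\<kappa> i > e j\<close> truncated subtraction makes the divisor
        1. The weight bound below is an equality when \<open>\<kappa> i \<le> e j\<close>.\<close>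
      show "p ^ (e j - \<kappa> i) dvd a i j"
      proof (cases "\<kappa> i \<le> e j")
        case True
        then have "p ^ e j = p ^ \<kappa> i * p ^ (e j - \<kappa> i)" by (simp flip: power_add)
        then show ?thesis using ann[OF i j] p0 by simp
      qed simp
      show "p ^ (E - \<kappa> i) \<le> p ^ (e j - \<kappa> i) * w j"
        unfolding w_def power_add[symmetric]
        using p0 eE[OF j] by (intro power_increasing) auto
    qed
  qed
  then have "(\<Prod>i\<in>L. Poly_Mapping.single (y i) 1 - 1) \<in> F (\<Sum>i\<in>L. p ^ (E - \<kappa> i))"
    by (intro F_prod finL)
  then have "(\<Prod>i\<in>L. Poly_Mapping.single (y i) 1 - 1) \<in> Z"
    using large by (intro F_subset_Z) (auto simp: w_def)
  then have "int p dvd coeff_sum D (\<Prod>i\<in>L. Poly_Mapping.single (y i) 1 - 1)"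
    unfolding Z_def by (auto dest: spec[of _ 1])
  \<comment> \<open>Expanding the product gives a signed sum over the subsets of \<open>L\<close>;
    by \<open>contra\<close> only the empty subset meets \<open>D\<close>.\<close>
  also have "(\<Prod>i\<in>L. Poly_Mapping.single (y i) (1::int) - 1) =
      (\<Sum>J\<in>Pow L. Poly_Mapping.single (\<Sum>i\<in>J. y i) 1 * (- 1) ^ card (L - J))"
    using prod_add[OF finL, of "\<lambda>i. Poly_Mapping.single (y i) (1::int)" "\<lambda>_. - 1"]
    by (simp add: prod_single_1)
  also have "coeff_sum D \<dots> = (\<Sum>J\<in>Pow L. (- 1) ^ card (L - J) * of_bool ((\<Sum>i\<in>J. y i) \<in> D))"
    by (simp add: coeff_sum_sum coeff_sum_mult_minus_1_power coeff_sum_single of_bool_def)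
  also have "\<dots> = (\<Sum>J\<in>{{}}. (- 1) ^ card (L - J) * of_bool ((\<Sum>i\<in>J. y i) \<in> D))"
  proof (rule sum.mono_neutral_right)
    show "\<forall>J\<in>Pow L - {{}}. (- 1) ^ card (L - J) * of_bool ((\<Sum>i\<in>J. y i) \<in> D) = (0::int)"
    proof
      fix J assume "J \<in> Pow L - {{}}"
      then have "\<not> (\<forall>j\<in>I. p ^ e j dvd (\<Sum>i\<in>J. a i j))" using contra by blast
      then have "(\<Sum>i\<in>J. y i) \<notin> D" by (simp add: D_def sum_fun_apply y_def)
      then show "(- 1) ^ card (L - J) * of_bool ((\<Sum>i\<in>J. y i) \<in> D) = (0::int)" by simp
    qed
  qed (use finL in auto)
  also have "\<dots> = (- 1) ^ card L" by (simp add: D_def)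
  finally have "int p dvd 1" by (simp add: dvd_minus_iff minus_one_power_iff split: if_splits)
  then show False using prime not_prime_unit by force
qed

section \<open>Integer coordinates on a finite product of cyclic groups\<close>

text \<open>Coordinates turn products in \<open>G\<close> into congruences modulo
  \<open>m j\<close>. Positivity of \<open>m j\<close> excludes the infinite group
  \<open>integer_mod_group 0\<close> and makes the coordinate range
  \<open>{0..<m j}\<close>.\<close>

locale cyclic_coordinates = comm_group G for G (structure) +
  fixes I :: "'i set" and m :: "'i \<Rightarrow> nat" and \<phi> :: "'a \<Rightarrow> 'i \<Rightarrow> int"
  assumes finite_I: "finite I" and m_pos: "j \<in> I \<Longrightarrow> 0 < m j"
    and iso: "\<phi> \<in> iso G (product_group I (\<lambda>j. integer_mod_group (m j)))"
begin

abbreviation H where "H \<equiv> product_group I (\<lambda>j. integer_mod_group (m j))"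

lemma hom: "\<phi> \<in> hom G H"
  using iso by (simp add: iso_def)

lemma bij: "bij_betw \<phi> (carrier G) (carrier H)"
  using iso by (simp add: iso_def)

lemma group_H: "group H"
  by simp

lemma carrier_H: "carrier H = (\<Pi>\<^sub>E j\<in>I. {0..<int (m j)})"
  unfolding carrier_product_group
  by (rule PiE_cong) (auto simp: carrier_integer_mod_group dest: m_pos)

lemma coord_range: "x \<in> carrier G \<Longrightarrow> j \<in> I \<Longrightarrow> \<phi> x j \<in> {0..<int (m j)}"
  using bij_betwE[OF bij] carrier_H by (metis PiE_mem)

lemma coord_mult:
  "x \<in> carrier G \<Longrightarrow> y \<in> carrier G \<Longrightarrow> j \<in> I \<Longrightarrow> \<phi> (x \<otimes> y) j = (\<phi> x j + \<phi> y j) mod int (m j)"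
  using hom_mult[OF hom] by simp

lemma coord_one: "j \<in> I \<Longrightarrow> \<phi> \<one> j = 0"
  using hom_one[OF hom is_group group_H] by simp

lemma eq_one_iff: "x \<in> carrier G \<Longrightarrow> x = \<one> \<longleftrightarrow> (\<forall>j\<in>I. \<phi> x j = 0)"
proof (safe intro!: coord_one)
  assume x: "x \<in> carrier G" "\<forall>j\<in>I. \<phi> x j = 0"
  have "\<phi> x \<in> carrier H" "\<phi> \<one> \<in> carrier H"
    using bij_betwE[OF bij] x by auto
  then have "\<phi> x = \<phi> \<one>"
    unfolding carrier_H by (rule PiE_ext) (simp add: coord_one x)
  then show "x = \<one>"
    using bij x by (auto simp: bij_betw_def inj_on_def)
qed

lemma coord_finprod:
  "finite A \<Longrightarrow> f \<in> A \<rightarrow> carrier G \<Longrightarrow> j \<in> I \<Longrightarrow>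
     \<phi> (finprod G f A) j = (\<Sum>i\<in>A. \<phi> (f i) j) mod int (m j)"
  by (induction A rule: finite_induct)
    (auto simp: coord_one coord_mult finprod_closed mod_add_right_eq Pi_iff)

lemma coord_pow:
  assumes "x \<in> carrier G" "j \<in> I"
  shows "\<phi> (x [^] (k::nat)) j = (int k * \<phi> x j) mod int (m j)"
proof (induction k)
  case (Suc k)
  then show ?case
    using assms by (simp add: coord_mult mod_add_left_eq mod_add_right_eq distrib_right add.commute)
qed (simp add: coord_one assms)

lemma finprod_eq_one_iff:
  assumes "finite A" "f \<in> A \<rightarrow> carrier G"
  shows "finprod G f A = \<one> \<longleftrightarrow> (\<forall>j\<in>I. int (m j) dvd (\<Sum>i\<in>A. \<phi> (f i) j))"
  using assms by (subst eq_one_iff) (auto simp: coord_finprod mod_eq_0_iff_dvd finprod_closed)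

lemma order_eq: "order G = (\<Prod>j\<in>I. m j)"
  using bij_betw_same_card[OF bij] finite_I unfolding carrier_H
  by (simp add: order_def card_PiE)

lemma finite_carrier: "finite (carrier G)"
  using bij_betw_finite[OF bij] finite_I unfolding carrier_H by (simp add: finite_PiE)

text \<open>The value \<open>1 mod int (m j)\<close> is 0 when \<open>m j = 1\<close>, which keeps
  the vector in the carrier for a trivial summand.\<close>

lemma ex_basis:
  assumes "j \<in> I"
  obtains b where "b \<in> carrier G" "\<And>k. k \<in> I \<Longrightarrow> \<phi> b k = (if k = j then 1 mod int (m j) else 0)"
proof -
  define v where "v = (\<lambda>k\<in>I. if k = j then 1 mod int (m j) else 0)"
  have "v \<in> carrier H" unfolding carrier_H v_def using m_pos by auto
  then obtain b where "b \<in> carrier G" "\<phi> b = v"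
    using bij unfolding bij_betw_def by (metis imageE)
  then show ?thesis using that by (simp add: v_def)
qed

end

section \<open>Zero-sum free multisets and the maximum defining k(G)\<close>

context comm_group begin

text \<open>The \<open>l + 1\<close> initial products are pairwise distinct.\<close>

lemma zero_sum_free_length:
  assumes fin: "finite (carrier G)" and g: "\<And>i. i \<in> {1..l} \<Longrightarrow> g i \<in> carrier G"
    and free: "zero_sum_free G g {1..l}"
  shows "l < order G"
proof -
  have cl: "g \<in> J \<rightarrow> carrier G" if "J \<subseteq> {1..l}" for J using that g by auto
  have "inj_on (\<lambda>k. finprod G g {1..k}) {0..l}"
  proof (rule linorder_inj_onI')
    fix i j assume ij: "i \<in> {0..l}" "j \<in> {0..l}" "i < j"
    then have "{1..j} = {1..i} \<union> {i<..j}" by auto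
    then have "finprod G g {1..j} = finprod G g {1..i} \<otimes> finprod G g {i<..j}"
      using ij by (simp only:) (intro finprod_Un_disjoint cl; auto)
    moreover have "finprod G g {i<..j} \<noteq> \<one>"
      using free[unfolded zero_sum_free_def zero_sum_def, rule_format, of "{i<..j}"] ij
      by fastforce
    moreover have "finprod G g {1..i} \<in> carrier G" "finprod G g {i<..j} \<in> carrier G"
      using ij by (intro finprod_closed cl; auto)+
    ultimately show "finprod G g {1..i} \<noteq> finprod G g {1..j}"
      by (metis l_cancel_one' )
  qed
  moreover have "(\<lambda>k. finprod G g {1..k}) ` {0..l} \<subseteq> carrier G"
    by (auto intro!: finprod_closed cl)
  ultimately have "card {0..l} \<le> card (carrier G)"
    using fin card_inj_on_le by blast
  then show ?thesis by (simp add: order_def)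
qed

lemma cross_number_cong: "(\<And>i. i \<in> A \<Longrightarrow> f i = g i) \<Longrightarrow> cross_number G f A = cross_number G g A"
  by (simp add: cross_number_def)

text \<open>Finiteness is what gives the \<open>Max\<close> in \<open>group_cross_number\<close> its
  meaning. The length is below the order, and only the restriction of \<open>g\<close> to
  \<open>{1..l}\<close> matters, which leaves finitely many functions.\<close>

lemma finite_cross_numbers:
  assumes "finite (carrier G)"
  shows "finite {cross_number G g {1..l} | l g.
            indexed_multiset_over (carrier G - {\<one>}) l g \<and> zero_sum_free G g {1..l}}"
proof (rule finite_subset)
  let ?A = "SIGMA l:{..<order G}. {1..l} \<rightarrow>\<^sub>E carrier G"
  show "finite ((\<lambda>(l, g). cross_number G g {1..l}) ` ?A)"
    using assms by (intro finite_imageI finite_SigmaI finite_PiE) auto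
  show "{cross_number G g {1..l} | l g.
      indexed_multiset_over (carrier G - {\<one>}) l g \<and> zero_sum_free G g {1..l}} \<subseteq>
      (\<lambda>(l, g). cross_number G g {1..l}) ` ?A"
  proof safe
    fix l g assume g: "indexed_multiset_over (carrier G - {\<one>}) l g" "zero_sum_free G g {1..l}"
    then have gc: "g i \<in> carrier G" if "i \<in> {1..l}" for i
      using that by (auto simp: indexed_multiset_over_def)
    have "l < order G" using zero_sum_free_length[OF assms gc g(2)] .
    moreover have "cross_number G g {1..l} = cross_number G (restrict g {1..l}) {1..l}"
      by (rule cross_number_cong) simp
    ultimately show "cross_number G g {1..l} \<in> (\<lambda>(l, g). cross_number G g {1..l}) ` ?A"
      using gc by (intro image_eqI[of _ _ "(l, restrict g {1..l})"]) auto
  qed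
qed

text \<open>Reindexing by a bijection with \<open>{1..card L}\<close> frees the bound from initial
  segments; what remains after deleting elements is not indexed by one.\<close>

lemma cross_number_le_group_cross_number:
  assumes fin: "finite (carrier G)" and L: "finite L"
    and g: "\<And>i. i \<in> L \<Longrightarrow> g i \<in> carrier G - {\<one>}" and free: "zero_sum_free G g L"
  shows "cross_number G g L \<le> group_cross_number G"
proof -
  obtain h where h: "bij_betw h {1..card L} L"
    using ex_bij_betw_nat_finite_1[OF L] by blast
  define g' where "g' = g \<circ> h"
  have hL: "h ` {1..card L} = L" "inj_on h {1..card L}" using h by (auto simp: bij_betw_def)
  have "indexed_multiset_over (carrier G - {\<one>}) (card L) g'"
    using g hL by (auto simp: indexed_multiset_over_def g'_def)
  moreover have "zero_sum_free G g' {1..card L}"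
    unfolding zero_sum_free_def zero_sum_def
  proof safe
    fix J x assume J: "J \<subseteq> {1..card L}" "finprod G g' J = \<one>" "x \<in> J"
    have "finprod G g (h ` J) = finprod G (\<lambda>x. g (h x)) J"
      using J hL g by (intro finprod_reindex) (auto intro: inj_on_subset)
    then have "finprod G g (h ` J) = \<one>" using J by (simp add: g'_def comp_def)
    moreover have "h ` J \<subseteq> L" "h ` J \<noteq> {}" using J hL by auto
    ultimately show "x \<in> {}" using free by (auto simp: zero_sum_free_def zero_sum_def)
  qed
  moreover have "cross_number G g L = cross_number G g' {1..card L}"
    unfolding cross_number_def g'_def comp_def
    by (rule sum.reindex_bij_betw[OF h, symmetric])
  ultimately show ?thesis
    unfolding group_cross_number_def using finite_cross_numbers[OF fin]
    by (intro Max_ge) auto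
qed

lemma group_cross_number_le:
  assumes fin: "finite (carrier G)"
    and bound: "\<And>l g. (\<And>i. i \<in> {1..l} \<Longrightarrow> g i \<in> carrier G) \<Longrightarrow> zero_sum_free G g {1..l} \<Longrightarrow>
      cross_number G g {1..l} \<le> B"
  shows "group_cross_number G \<le> B"
  unfolding group_cross_number_def
proof (rule Max.boundedI[OF finite_cross_numbers[OF fin]])
  have "indexed_multiset_over (carrier G - {\<one>}) 0 undefined \<and> zero_sum_free G undefined {1..0}"
    by (auto simp: indexed_multiset_over_def zero_sum_free_def)
  then show "{cross_number G g {1..l} | l g.
      indexed_multiset_over (carrier G - {\<one>}) l g \<and> zero_sum_free G g {1..l}} \<noteq> {}"
    by blast
next
  fix a assume "a \<in> {cross_number G g {1..l} | l g.
      indexed_multiset_over (carrier G - {\<one>}) l g \<and> zero_sum_free G g {1..l}}"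
  then obtain l g where a: "a = cross_number G g {1..l}"
    "indexed_multiset_over (carrier G - {\<one>}) l g" "zero_sum_free G g {1..l}" by blast
  then show "a \<le> B" using bound[of l g] by (auto simp: indexed_multiset_over_def)
qed

end

section \<open>Cross numbers of products of cyclic groups and of p-groups\<close>

context cyclic_coordinates begin

text \<open>The witness consists of \<open>m j - 1\<close> copies of a generator of each summand. In
  a nonempty submultiset some generator \<open>b j\<close> occurs between 1 and
  \<open>m j - 1\<close> times, and this count is the \<open>j\<close>-th coordinate of the sum
  modulo \<open>m j\<close>.\<close>

lemma sum_le_group_cross_number: "(\<Sum>j\<in>I. (real (m j) - 1) / real (m j)) \<le> group_cross_number G"
proof -
  obtain b where b: "\<And>j. j \<in> I \<Longrightarrow> b j \<in> carrier G"
    "\<And>j k. j \<in> I \<Longrightarrow> k \<in> I \<Longrightarrow> \<phi> (b j) k = (if k = j then 1 mod int (m j) else 0)"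
  proof -
    have "\<forall>j\<in>I. \<exists>b. b \<in> carrier G \<and> (\<forall>k\<in>I. \<phi> b k = (if k = j then 1 mod int (m j) else 0))"
    proof
      fix j assume "j \<in> I"
      then show "\<exists>b. b \<in> carrier G \<and> (\<forall>k\<in>I. \<phi> b k = (if k = j then 1 mod int (m j) else 0))"
        by (rule ex_basis) blast
    qed
    from bchoice[OF this] obtain b where "\<forall>j\<in>I. b j \<in> carrier G \<and>
        (\<forall>k\<in>I. \<phi> (b j) k = (if k = j then 1 mod int (m j) else 0))" ..
    then show ?thesis by (intro that[of b]) simp_all
  qed
  have ord_b: "ord (b j) = m j" if j: "j \<in> I" for j
  proof -
    have "b j [^] k = \<one> \<longleftrightarrow> m j dvd k" for k :: nat
    proof -
      have "b j [^] k = \<one> \<longleftrightarrow> \<phi> (b j [^] k) j = 0"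
        using b j by (subst eq_one_iff) (auto simp: coord_pow)
      then show ?thesis
        using b j by (simp add: coord_pow mod_mult_right_eq mod_eq_0_iff_dvd)
    qed
    then show ?thesis using ord_unique[OF b(1)[OF j]] by blast
  qed
  \<comment> \<open>A pair \<open>(j, k)\<close> labels the \<open>k\<close>-th copy of
    \<open>b j\<close>; \<open>h\<close> numbers the copies consecutively.\<close>
  define T where "T = (SIGMA j:I. {1..<m j})"
  have finT: "finite T" using finite_I by (auto simp: T_def)
  obtain h where h: "bij_betw h {1..card T} T"
    using ex_bij_betw_nat_finite_1[OF finT] by blast
  then have hT: "h ` {1..card T} = T" "inj_on h {1..card T}" by (auto simp: bij_betw_def)
  define g where "g i = b (fst (h i))" for i
  have hI: "fst (h i) \<in> I" "snd (h i) \<in> {1..<m (fst (h i))}" if "i \<in> {1..card T}" for i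
  proof -
    have "h i \<in> T" using that hT(1) by blast
    then show "fst (h i) \<in> I" "snd (h i) \<in> {1..<m (fst (h i))}" by (auto simp: T_def)
  qed
  have gc: "g i \<in> carrier G - {\<one>}" if i: "i \<in> {1..card T}" for i
  proof -
    have "ord (g i) \<noteq> 1" using ord_b hI[OF i] by (auto simp: g_def)
    then show ?thesis using ord_eq_1 b hI[OF i] by (auto simp: g_def)
  qed
  have "zero_sum_free G g {1..card T}"
    unfolding zero_sum_free_def zero_sum_def
  proof safe
    fix J i assume J: "J \<subseteq> {1..card T}" "finprod G g J = \<one>" "i \<in> J"
    have finJ: "finite J" using J(1) finite_subset by blast
    define j where "j = fst (h i)"
    have jI: "j \<in> I" using hI J by (auto simp: j_def)
    \<comment> \<open>These are the copies of \<open>b j\<close> in \<open>J\<close>. Injectivity of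
      \<open>h\<close> bounds their number by \<open>m j - 1\<close>, and \<open>i\<close> itself is
      among them.\<close>
    define C where "C = {i\<in>J. fst (h i) = j}"
    have mj: "1 < m j" using hI[of i] J by (auto simp: j_def)
    have "h ` C \<subseteq> {j} \<times> {1..<m j}"
    proof
      fix x assume "x \<in> h ` C"
      then obtain k where "x = h k" "k \<in> J" "fst (h k) = j" by (auto simp: C_def)
      then show "x \<in> {j} \<times> {1..<m j}" using hI[of k] J(1) by (cases "h k") auto
    qed
    moreover have "inj_on h C" using hT(2) J(1) by (auto simp: C_def intro: inj_on_subset)
    ultimately have "card C \<le> card ({j} \<times> {1..<m j})"
      by (intro card_inj_on_le) auto
    then have "card C < m j" using mj by simp
    moreover have "card C > 0" using J finJ by (auto simp: C_def j_def card_gt_0_iff)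
    moreover have "int (m j) dvd (\<Sum>i\<in>J. \<phi> (g i) j)"
      using finprod_eq_one_iff[OF finJ, of g] J jI gc by blast
    moreover have "(\<Sum>i\<in>J. \<phi> (g i) j) = (\<Sum>i\<in>J. of_bool (fst (h i) = j))"
      using J(1) hI b jI mj by (intro sum.cong) (auto simp: g_def)
    moreover have "\<dots> = int (card C)"
      using finJ by (simp add: C_def Int_def)
    ultimately show "i \<in> {}" by (auto dest: zdvd_imp_le)
  qed
  then have "cross_number G g {1..card T} \<le> group_cross_number G"
    using gc by (intro cross_number_le_group_cross_number finite_carrier) auto
  also have "cross_number G g {1..card T} = (\<Sum>i\<in>{1..card T}. (\<lambda>x. 1 / real (m (fst x))) (h i))"
    unfolding cross_number_def using ord_b hI by (intro sum.cong) (auto simp: g_def)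
  also have "\<dots> = (\<Sum>x\<in>T. 1 / real (m (fst x)))"
    by (rule sum.reindex_bij_betw[OF h])
  also have "\<dots> = (\<Sum>j\<in>I. \<Sum>k\<in>{1..<m j}. 1 / real (m j))"
    unfolding T_def using finite_I by (subst sum.Sigma) (auto intro!: sum.cong)
  also have "\<dots> = (\<Sum>j\<in>I. (real (m j) - 1) / real (m j))"
    using m_pos by (intro sum.cong) (auto simp: of_nat_diff Suc_leI)
  finally show ?thesis .
qed

text \<open>The contrapositive of \<open>ex_zero_sum_weighted\<close> for the coordinates of the
  \<open>g i\<close>, divided by \<open>p ^ E\<close>.\<close>

lemma cross_number_p_group_le:
  assumes prime: "prime p" and m: "\<And>j. j \<in> I \<Longrightarrow> m j = p ^ e j"
    and L: "finite L" and g: "\<And>i. i \<in> L \<Longrightarrow> g i \<in> carrier G" and free: "zero_sum_free G g L"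
  shows "cross_number G g L \<le> (\<Sum>j\<in>I. (real (p ^ e j) - 1) / real (p ^ e j))"
proof -
  \<comment> \<open>With \<open>p ^ E\<close> the group order, \<open>E\<close> bounds every
    \<open>e j\<close> and the exponent of every element order.\<close>
  define E where "E = (\<Sum>j\<in>I. e j)"
  have p: "p > 1" "p > 0" using prime_gt_1_nat[OF prime] by simp_all
  have ordG: "order G = p ^ E" using m by (simp add: order_eq E_def power_sum)
  have "\<exists>k\<le>E. ord (g i) = p ^ k" if "i \<in> L" for i
    using ord_dvd_group_order[OF g[OF that]] ordG divides_primepow_nat[OF prime] by auto
  then obtain \<kappa> where \<kappa>: "\<And>i. i \<in> L \<Longrightarrow> \<kappa> i \<le> E \<and> ord (g i) = p ^ \<kappa> i" by metis
  have eE: "e j \<le> E" if "j \<in> I" for j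
    using that finite_I unfolding E_def by (intro member_le_sum) auto
  define a where "a i j = nat (\<phi> (g i) j)" for i j
  have a: "int (a i j) = \<phi> (g i) j" if "i \<in> L" "j \<in> I" for i j
    using coord_range[OF g[OF that(1)] that(2)] by (simp add: a_def)
  have ann: "p ^ e j dvd p ^ \<kappa> i * a i j" if ij: "i \<in> L" "j \<in> I" for i j
  proof -
    have "g i [^] (p ^ \<kappa> i) = \<one>" using \<kappa>[OF ij(1)] g[OF ij(1)] pow_ord_eq_1 by metis
    then have "\<phi> (g i [^] (p ^ \<kappa> i)) j = 0" using coord_one ij by simp
    then have "int (m j) dvd int (p ^ \<kappa> i) * int (a i j)"
      using a[OF ij] g[OF ij(1)] ij by (simp add: coord_pow mod_eq_0_iff_dvd)
    then show ?thesis using m ij by (simp flip: of_nat_mult of_nat_power)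
  qed
  have "(\<Sum>i\<in>L. p ^ (E - \<kappa> i)) \<le> (\<Sum>j\<in>I. (p ^ e j - 1) * p ^ (E - e j))"
  proof (rule ccontr)
    assume "\<not> ?thesis"
    then have large: "(\<Sum>j\<in>I. (p ^ e j - 1) * p ^ (E - e j)) < (\<Sum>i\<in>L. p ^ (E - \<kappa> i))" by simp
    have "\<exists>J\<subseteq>L. J \<noteq> {} \<and> (\<forall>j\<in>I. p ^ e j dvd (\<Sum>i\<in>J. a i j))"
      by (rule ex_zero_sum_weighted[OF finite_I prime L eE _ ann large]) (use \<kappa> in auto)
    then obtain J where J: "J \<subseteq> L" "J \<noteq> {}" "\<forall>j\<in>I. p ^ e j dvd (\<Sum>i\<in>J. a i j)" by blast
    have "(\<Sum>i\<in>J. \<phi> (g i) j) = int (\<Sum>i\<in>J. a i j)" if "j \<in> I" for j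
      using a J(1) that by (auto intro!: sum.cong)
    then have "finprod G g J = \<one>"
      using J m g L finite_subset[OF J(1) L]
      by (subst finprod_eq_one_iff) (auto simp del: of_nat_sum of_nat_power)
    then show False using free J by (auto simp: zero_sum_free_def zero_sum_def)
  qed
  then have "real (\<Sum>i\<in>L. p ^ (E - \<kappa> i)) / p ^ E \<le> real (\<Sum>j\<in>I. (p ^ e j - 1) * p ^ (E - e j)) / p ^ E"
    using p by (intro divide_right_mono of_nat_mono) auto
  moreover have pow: "real p ^ (E - k) = real p ^ E / real p ^ k" if "k \<le> E" for k
    using p that by (simp add: power_diff)
  moreover have "real (\<Sum>i\<in>L. p ^ (E - \<kappa> i)) / p ^ E = cross_number G g L"
    unfolding cross_number_def of_nat_sum sum_divide_distrib
    using \<kappa> p by (intro sum.cong) (auto simp: pow)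
  moreover have "real (\<Sum>j\<in>I. (p ^ e j - 1) * p ^ (E - e j)) / p ^ E =
      (\<Sum>j\<in>I. (real (p ^ e j) - 1) / real (p ^ e j))"
    unfolding of_nat_sum sum_divide_distrib
    using eE p by (intro sum.cong) (auto simp: pow of_nat_diff)
  ultimately show ?thesis by simp
qed

theorem group_cross_number_p_group:
  assumes "prime p" "\<And>j. j \<in> I \<Longrightarrow> m j = p ^ e j"
  shows "group_cross_number G = (\<Sum>j\<in>I. (real (p ^ e j) - 1) / real (p ^ e j))"
proof (rule antisym)
  show "group_cross_number G \<le> (\<Sum>j\<in>I. (real (p ^ e j) - 1) / real (p ^ e j))"
    using assms by (intro group_cross_number_le finite_carrier cross_number_p_group_le) auto
  show "(\<Sum>j\<in>I. (real (p ^ e j) - 1) / real (p ^ e j)) \<le> group_cross_number G"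
    using sum_le_group_cross_number assms(2) by simp
qed

end

section \<open>Factorizations and the consequences of their uniqueness\<close>

lemma partition_on_Un:
  assumes "partition_on A P" "partition_on B Q" "A \<inter> B = {}"
  shows "partition_on (A \<union> B) (P \<union> Q)"
  using assms unfolding partition_on_def by (auto intro!: disjoint_union)

context comm_group begin

lemma zero_sum_diff:
  assumes "finite J" "K \<subseteq> J" "g \<in> J \<rightarrow> carrier G" "zero_sum G g J" "zero_sum G g K"
  shows "zero_sum G g (J - K)"
proof -
  have g: "g \<in> K \<rightarrow> carrier G" "g \<in> J - K \<rightarrow> carrier G" using assms by auto
  have "K \<union> (J - K) = J" using assms(2) by blast
  then have "finprod G g J = finprod G g K \<otimes> finprod G g (J - K)"
    using finprod_Un_disjoint[of K "J - K" g] assms(1) g finite_subset[OF assms(2,1)] by auto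
  then show ?thesis using assms g by (simp add: zero_sum_def finprod_closed)
qed

text \<open>Strong induction on the index set: if it is not minimal, a proper zero-sum part and its
  complement are both zero-sum and are factored separately.\<close>

lemma ex_minimal_zero_sum_partition:
  assumes "finite J" "g \<in> J \<rightarrow> carrier G" "zero_sum G g J"
  shows "\<exists>Q. partition_on J Q \<and> (\<forall>I\<in>Q. minimal_zero_sum G g I)"
  using assms
proof (induction J rule: finite_psubset_induct)
  case (psubset J)
  consider "J = {}" | "J \<noteq> {}" "minimal_zero_sum G g J"
    | K where "K \<noteq> {}" "K \<subset> J" "zero_sum G g K"
    using psubset.prems by (auto simp: minimal_zero_sum_def)
  then show ?case
  proof cases
    case 1
    then show ?thesis by (auto simp: partition_on_empty)
  next
    case 2
    then show ?thesis using partition_on_space[of J] by auto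
  next
    case 3
    have "zero_sum G g (J - K)" using 3 psubset by (intro zero_sum_diff) auto
    then obtain Q2 where Q2: "partition_on (J - K) Q2" "\<forall>I\<in>Q2. minimal_zero_sum G g I"
      using psubset.IH[of "J - K"] 3 psubset.prems by blast
    obtain Q1 where Q1: "partition_on K Q1" "\<forall>I\<in>Q1. minimal_zero_sum G g I"
      using psubset.IH[of K] 3 psubset.prems by blast
    have "partition_on (K \<union> (J - K)) (Q1 \<union> Q2)"
      using Q1 Q2 by (intro partition_on_Un) auto
    moreover have "K \<union> (J - K) = J" using 3(2) by blast
    ultimately have "partition_on J (Q1 \<union> Q2)" by (simp only:)
    then show ?thesis using Q1 Q2 by blast
  qed
qed

text \<open>
  A zero-sum submultiset and its complement can be factored separately, and the resulting
  factorization of the whole multiset has to be the given one.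
\<close>

lemma UFIM_zero_sum_contains_block:
  assumes U: "UFIM G l g" and P: "irreducible_factorization G l g P"
    and J: "J \<subseteq> {1..l}" "zero_sum G g J" and x: "x \<in> J" "x \<in> I" and I: "I \<in> P"
  shows "I \<subseteq> J"
proof -
  have g: "g \<in> {1..l} \<rightarrow> carrier G" and zs: "zero_sum G g {1..l}"
    using U by (auto simp: UFIM_def indexed_multiset_over_def)
  have fin: "finite J" using J(1) finite_subset by blast
  obtain Q1 where Q1: "partition_on J Q1" "\<forall>I\<in>Q1. minimal_zero_sum G g I"
    using ex_minimal_zero_sum_partition[OF fin _ J(2)] g J(1) by blast
  have "zero_sum G g ({1..l} - J)" using g zs J by (intro zero_sum_diff) auto
  then obtain Q2 where Q2: "partition_on ({1..l} - J) Q2" "\<forall>I\<in>Q2. minimal_zero_sum G g I"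
    using ex_minimal_zero_sum_partition[of "{1..l} - J" g] g by blast
  have "partition_on (J \<union> ({1..l} - J)) (Q1 \<union> Q2)"
    using Q1 Q2 by (intro partition_on_Un) auto
  moreover have "J \<union> ({1..l} - J) = {1..l}" using J(1) by blast
  ultimately have "partition_on {1..l} (Q1 \<union> Q2)" by (simp only:)
  then have "irreducible_factorization G l g (Q1 \<union> Q2)"
    using Q1 Q2 by (auto simp: irreducible_factorization_def)
  then have "P = Q1 \<union> Q2" using U P by (auto simp: UFIM_def)
  moreover have "I \<notin> Q2" using x partition_onD1[OF Q2(1)] by auto
  ultimately show "I \<subseteq> J" using I partition_onD1[OF Q1(1)] by auto
qed

text \<open>One representative per block has pairwise distinct subset sums. If \<open>A\<close> and
  \<open>B\<close> give the same sum, exchanging the representatives of \<open>B\<close> for those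
  of \<open>A\<close> inside \<open>\<Union>B\<close> keeps the sum zero. The result still meets
  every block of \<open>B\<close>, so by uniqueness contains it together with its representative,
  which can only come from \<open>A\<close>.\<close>

lemma UFIM_two_power_card_le_order:
  assumes fin: "finite (carrier G)"
    and U: "UFIM G l g" and P: "irreducible_factorization G l g P"
  shows "2 ^ card P \<le> order G"
proof -
  have g: "g i \<in> carrier G" "g i \<noteq> \<one>" if "i \<in> {1..l}" for i
    using that U by (auto simp: UFIM_def indexed_multiset_over_def)
  have zsP: "zero_sum G g I" if "I \<in> P" for I
    using P that by (auto simp: irreducible_factorization_def minimal_zero_sum_def)
  have part: "partition_on {1..l} P" using P by (simp add: irreducible_factorization_def)
  have UnP: "\<Union>P = {1..l}" using partition_onD1[OF part] by simp
  have finP: "finite P" using finite_elements[OF _ part] by simp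
  have finI: "finite I" if "I \<in> P" for I
  proof (rule finite_subset)
    show "I \<subseteq> {1..l}" using UnP that by blast
  qed simp
  have disj: "I = K" if "I \<in> P" "K \<in> P" "x \<in> I" "x \<in> K" for I K x
    using partition_onD2[OF part] that by (auto simp: disjoint_def)
  define x where "x I = (SOME i. i \<in> I)" for I :: "nat set"
  have x: "x I \<in> I" if "I \<in> P" for I
    using partition_onD3[OF part] that by (auto simp: x_def some_in_eq)
  have cl: "g \<in> J \<rightarrow> carrier G" if "J \<subseteq> {1..l}" for J using g that by auto
  \<comment> \<open>A singleton block would consist of the neutral element. The second element keeps
    the block visible after its representative is removed.\<close>
  have ex_other: "\<exists>y\<in>I. y \<noteq> x I" if "I \<in> P" for I
  proof (rule ccontr)
    assume "\<not> ?thesis"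
    then have I: "I = {x I}" using x[OF that] by blast
    have xI: "x I \<in> {1..l}" using x that UnP by blast
    have "finprod G g {x I} = g (x I)" using g(1)[OF xI] by simp
    moreover have "finprod G g {x I} = \<one>" using zsP[OF that] I by (metis zero_sum_def)
    ultimately show False using g(2)[OF xI] by simp
  qed
  have sub: "B \<subseteq> A" if AB: "A \<subseteq> P" "B \<subseteq> P" and eq: "finprod G g (x ` A) = finprod G g (x ` B)" for A B
  proof
    fix I assume I: "I \<in> B"
    have xU: "x ` A \<subseteq> {1..l}" "\<Union>B \<subseteq> {1..l}" "x ` B \<subseteq> \<Union>B"
      using AB x UnP by blast+
    define R where "R = \<Union>B - x ` B"
    have R: "R \<subseteq> {1..l}" using xU by (auto simp: R_def)
    have cls: "g \<in> x ` A \<rightarrow> carrier G" "g \<in> x ` B \<rightarrow> carrier G" "g \<in> R \<rightarrow> carrier G"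
      by (rule cl[OF xU(1)], rule cl[OF subset_trans[OF xU(3,2)]], rule cl[OF R])
    \<comment> \<open>A representative of a block in \<open>A\<close> lying in a block of
      \<open>B\<close> represents that very block, hence was removed from \<open>R\<close>.\<close>
    have disjR: "x ` A \<inter> R = {}"
    proof (rule ccontr)
      assume "\<not> ?thesis"
      then obtain K L where "K \<in> A" "L \<in> B" "x K \<in> L" "x K \<notin> x ` B" by (auto simp: R_def)
      then show False using disj[of K L "x K"] x AB by blast
    qed
    have fins: "finite (x ` A)" "finite (x ` B)" "finite R"
      using AB finP finite_subset R by (auto intro: finite_subset[of _ P] finite_subset[of R])
    have "finprod G g (\<Union>B) = finprod G (finprod G g) B"
      using AB finI finite_subset[OF AB(2) finP] cl[OF xU(2)]
        pairwise_subset[OF partition_onD2[OF part] AB(2)]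
      by (intro finprod_Union_disjoint) auto
    also have "\<dots> = \<one>"
      using AB zsP by (intro finprod_one_eqI[of B "finprod G g"]) (auto simp: zero_sum_def)
    finally have "finprod G g (x ` B \<union> R) = \<one>"
      using xU(3) by (simp add: R_def Un_absorb1)
    then have "finprod G g (x ` B) \<otimes> finprod G g R = \<one>"
      using fins cls by (subst (asm) finprod_Un_disjoint) (auto simp: R_def)
    then have "finprod G g (x ` A) \<otimes> finprod G g R = \<one>" by (simp add: eq)
    then have zs: "zero_sum G g (x ` A \<union> R)"
      unfolding zero_sum_def using fins disjR cls by (subst finprod_Un_disjoint) auto
    obtain y where y: "y \<in> I" "y \<noteq> x I" using ex_other I AB by blast
    have "y \<in> R" unfolding R_def
    proof
      show "y \<in> \<Union>B" using y I by blast
      show "y \<notin> x ` B" using y I disj[of I _ y] x AB by blast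
    qed
    then have "I \<subseteq> x ` A \<union> R"
      using UFIM_zero_sum_contains_block[OF U P _ zs, of y I] xU R y I AB by blast
    moreover have "x I \<in> I" "x I \<notin> R" using x I AB by (auto simp: R_def)
    ultimately have "x I \<in> x ` A" by blast
    then obtain K where K: "K \<in> A" "x I = x K" by blast
    have IK: "I \<in> P" "K \<in> P" using I K AB by blast+
    have "x I \<in> K" unfolding K(2) by (rule x[OF IK(2)])
    then show "I \<in> A" using disj[OF IK x[OF IK(1)]] K(1) by blast
  qed
  have "inj_on (\<lambda>A. finprod G g (x ` A)) (Pow P)"
  proof (rule inj_onI)
    fix A B assume "A \<in> Pow P" "B \<in> Pow P" "finprod G g (x ` A) = finprod G g (x ` B)"
    then show "A = B" using sub[of A B] sub[of B A] by auto
  qed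
  moreover have "(\<lambda>A. finprod G g (x ` A)) ` Pow P \<subseteq> carrier G"
  proof
    fix a assume "a \<in> (\<lambda>A. finprod G g (x ` A)) ` Pow P"
    then obtain A where A: "A \<subseteq> P" "a = finprod G g (x ` A)" by blast
    then have "x ` A \<subseteq> {1..l}" using x UnP by blast
    then show "a \<in> carrier G" unfolding A(2) by (intro finprod_closed cl)
  qed
  ultimately have "card (Pow P) \<le> card (carrier G)"
    using fin card_inj_on_le by blast
  then show ?thesis by (simp add: order_def card_Pow finP)
qed

text \<open>One element of order at least \<open>d\<close> is deleted from each block. A nonempty
  zero-sum remainder would contain a whole block, including its deleted element; the deleted
  elements contribute at most \<open>1 / d\<close> each.\<close>

lemma UFIM_cross_number_le:
  assumes fin: "finite (carrier G)"
    and U: "UFIM G l g" and P: "irreducible_factorization G l g P"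
    and d: "d > 0" and large: "\<And>I. I \<in> P \<Longrightarrow> \<exists>i\<in>I. d \<le> ord (g i)"
  shows "cross_number G g {1..l} \<le> group_cross_number G + real (card P) / real d"
proof -
  have g: "g i \<in> carrier G - {\<one>}" if "i \<in> {1..l}" for i
    using that U by (auto simp: UFIM_def indexed_multiset_over_def)
  have part: "partition_on {1..l} P" using P by (simp add: irreducible_factorization_def)
  have UnP: "\<Union>P = {1..l}" using partition_onD1[OF part] by simp
  have finP: "finite P" using finite_elements[OF _ part] by simp
  obtain x where x: "\<And>I. I \<in> P \<Longrightarrow> x I \<in> I \<and> d \<le> ord (g (x I))"
    using large by metis
  have sub: "x ` P \<subseteq> {1..l}" using x UnP by blast
  have "zero_sum_free G g ({1..l} - x ` P)"
    unfolding zero_sum_free_def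
  proof safe
    fix J y assume J: "J \<subseteq> {1..l} - x ` P" "zero_sum G g J" "y \<in> J"
    then obtain I where I: "I \<in> P" "y \<in> I" using UnP by blast
    then have "I \<subseteq> J" using UFIM_zero_sum_contains_block[OF U P _ J(2,3) I(2,1)] J(1) by blast
    then show "y \<in> {}" using x[OF I(1)] I(1) J(1) by blast
  qed
  then have "cross_number G g ({1..l} - x ` P) \<le> group_cross_number G"
    using g by (intro cross_number_le_group_cross_number fin) auto
  moreover have "cross_number G g (x ` P) \<le> real (card P) / real d"
  proof -
    have "cross_number G g (x ` P) \<le> (\<Sum>i\<in>x ` P. 1 / real d)"
      unfolding cross_number_def using x d
      by (intro sum_mono divide_left_mono) (auto simp: less_le_trans intro!: mult_pos_pos)
    also have "\<dots> = real (card (x ` P)) / real d" by simp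
    also have "\<dots> \<le> real (card P) / real d"
      using card_image_le[OF finP, of x] by (intro divide_right_mono) auto
    finally show ?thesis .
  qed
  moreover have "cross_number G g {1..l} = cross_number G g ({1..l} - x ` P) + cross_number G g (x ` P)"
    unfolding cross_number_def using sub by (intro sum.subset_diff) auto
  ultimately show ?thesis by simp
qed

end

section \<open>Numerical comparison and arithmetic of primary decompositions\<close>

text \<open>The comparison is termwise: if \<open>T\<close> is a summand of \<open>K1_star\<close>
  for the prime \<open>P\<close>, the matching summand of \<open>k_star\<close> is
  \<open>T - T / P\<close>, and \<open>T / P\<close> is at least \<open>T / C\<close>.\<close>

lemma K1_star_gap:
  assumes C: "\<And>i. i \<in> {1..n} \<Longrightarrow> 1 < p i \<and> real (p i) \<le> C"
    and e: "\<And>i j. i \<in> {1..n} \<Longrightarrow> j \<in> {1..r i} \<Longrightarrow> 1 \<le> e i j"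
  shows "k_star n r p e + K1_star n r p e / C \<le> K1_star n r p e"
  unfolding k_star_def K1_star_def sum_divide_distrib sum.distrib[symmetric]
proof (intro sum_mono)
  fix i j assume i: "i \<in> {1..n}" and j: "j \<in> {1..r i}"
  define P Q where "P = real (p i)" and "Q = real (p i) ^ (e i j - 1)"
  have P: "1 < P" "P \<le> C" using C[OF i] by (auto simp: P_def)
  have Q: "1 \<le> Q" using P by (auto simp: Q_def P_def)
  have pe: "real (p i) ^ e i j = P * Q"
    using e[OF i j] by (simp add: P_def Q_def flip: power_Suc)
  define T where "T = (P * Q - 1) / (P * Q - Q)"
  have PQ: "P * Q > Q" "P * Q \<ge> 1" using P Q mult_mono[of 1 P 1 Q] by auto
  then have T: "T \<ge> 0" by (simp add: T_def)
  have "(P * Q - 1) / (P * Q) = T - T / P"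
  proof -
    have "T = (P * Q - 1) / (Q * (P - 1))" by (simp add: T_def algebra_simps)
    then have "T * (P - 1) = (P * Q - 1) / Q" using P by simp
    moreover have "T - T / P = T * (P - 1) / P" using P by (simp add: field_simps)
    ultimately show ?thesis by (simp add: mult.commute)
  qed
  moreover have "T / C \<le> T / P" using T P by (intro divide_left_mono) auto
  ultimately show "(real (p i) ^ e i j - 1) / real (p i) ^ e i j +
      (real (p i) ^ e i j - 1) / (real (p i) ^ e i j - real (p i) ^ (e i j - 1)) / C \<le>
      (real (p i) ^ e i j - 1) / (real (p i) ^ e i j - real (p i) ^ (e i j - 1))"
    unfolding pe Q_def[symmetric] T_def[symmetric] by linarith
qed

lemma primary_decomposition_coordinates:
  assumes "primary_decomposition G n r p e"
  obtains \<phi> where "cyclic_coordinates G (SIGMA i:{1..n}. {1..r i}) (\<lambda>(i, j). p i ^ e i j) \<phi>"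
proof -
  from assms have pd: "comm_group G" "\<And>i. i \<in> {1..n} \<Longrightarrow> prime (p i)"
    "G \<cong> product_group (SIGMA i:{1..n}. {1..r i}) (\<lambda>(i, j). integer_mod_group (p i ^ e i j))"
    by (auto simp: primary_decomposition_def)
  then obtain \<phi> where "\<phi> \<in> iso G (product_group (SIGMA i:{1..n}. {1..r i})
      (\<lambda>(i, j). integer_mod_group (p i ^ e i j)))"
    by (auto simp: is_iso_def)
  moreover have "(\<lambda>(i, j). integer_mod_group (p i ^ e i j)) =
      (\<lambda>x. integer_mod_group ((\<lambda>(i, j). p i ^ e i j) x))"
    by (simp add: fun_eq_iff split: prod.split)
  ultimately have "cyclic_coordinates G (SIGMA i:{1..n}. {1..r i}) (\<lambda>(i, j). p i ^ e i j) \<phi>"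
    using pd by (auto simp: cyclic_coordinates_def cyclic_coordinates_axioms_def prime_gt_0_nat)
  then show ?thesis by (rule that)
qed

lemma primary_decomposition_order:
  assumes "primary_decomposition G n r p e"
  shows "order G = (\<Prod>i=1..n. \<Prod>j=1..r i. p i ^ e i j)"
proof -
  obtain \<phi> where "cyclic_coordinates G (SIGMA i:{1..n}. {1..r i}) (\<lambda>(i, j). p i ^ e i j) \<phi>"
    using primary_decomposition_coordinates[OF assms] .
  from cyclic_coordinates.order_eq[OF this] show ?thesis
    by (simp add: prod.Sigma)
qed

text \<open>The left side depends on \<open>G\<close> alone, so bounds on the primes transfer
  between the given decomposition and the one hidden in \<open>in_S\<close>.\<close>

lemma primary_decomposition_prime_factors:
  assumes pd: "primary_decomposition G n r p e"
  shows "prime_factors (order G) = p ` {1..n}"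
proof -
  have pr: "\<And>i. i \<in> {1..n} \<Longrightarrow> prime (p i)" and r: "\<And>i. i \<in> {1..n} \<Longrightarrow> 1 \<le> r i"
    and e: "\<And>i j. i \<in> {1..n} \<Longrightarrow> j \<in> {1..r i} \<Longrightarrow> 1 \<le> e i j"
    using pd by (auto simp: primary_decomposition_def)
  have "order G \<noteq> 0"
    using pd by (auto simp: primary_decomposition_def comm_group_def group.is_monoid
        monoid.order_gt_0_iff_finite)
  moreover have "q dvd order G \<longleftrightarrow> q \<in> p ` {1..n}" if q: "prime q" for q
  proof
    assume "q dvd order G"
    then obtain i j where ij: "i \<in> {1..n}" "j \<in> {1..r i}" "q dvd p i ^ e i j"
      unfolding primary_decomposition_order[OF pd] using q
      by (auto simp: prime_dvd_prod_iff)
    then have "q = p i"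
      using q pr prime_dvd_power primes_dvd_imp_eq by metis
    then show "q \<in> p ` {1..n}" using ij by blast
  next
    assume "q \<in> p ` {1..n}"
    then obtain i where i: "i \<in> {1..n}" "q = p i" by blast
    have "p i dvd p i ^ e i 1" using e[of i 1] r i by (intro dvd_power) auto
    also have "\<dots> dvd (\<Prod>j=1..r i. p i ^ e i j)" using r[OF i(1)] by (intro dvd_prodI) auto
    also have "\<dots> dvd order G"
      unfolding primary_decomposition_order[OF pd] using i by (intro dvd_prodI[of _ _ "\<lambda>i. \<Prod>j=1..r i. p i ^ e i j"]) auto
    finally show "q dvd order G" using i by simp
  qed
  ultimately show ?thesis
    using pr by (auto simp: prime_factors_dvd)
qed

lemma group_cross_number_single_prime:
  assumes pd: "primary_decomposition G 1 r p e"
  shows "group_cross_number G = k_star 1 r p e"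
proof -
  obtain \<phi> where \<phi>: "cyclic_coordinates G (SIGMA i:{1..1}. {1..r i}) (\<lambda>(i, j). p i ^ e i j) \<phi>"
    using primary_decomposition_coordinates[OF pd] .
  have "prime (p 1)" using pd by (auto simp: primary_decomposition_def)
  from cyclic_coordinates.group_cross_number_p_group[OF \<phi> this, of "\<lambda>(i, j). e i j"]
  have "group_cross_number G =
      (\<Sum>(i, j)\<in>(SIGMA i:{1..1}. {1..r i}). (real (p 1 ^ e i j) - 1) / real (p 1 ^ e i j))"
    by (auto simp: case_prod_unfold)
  also have "\<dots> = k_star 1 r p e"
    unfolding k_star_def by (subst sum.Sigma[symmetric]) auto
  finally show ?thesis .
qed

text \<open>The decomposition witnessing \<open>in_S\<close> may differ from the given one, hence
  the bound on primes is phrased through the group order. Each of the at most \<open>N\<close> prime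
  factors, counted with multiplicity, is at most \<open>C\<close>.\<close>

lemma log_order_le:
  assumes S: "in_S N G" and C: "1 < C" "\<And>q. q \<in> prime_factors (order G) \<Longrightarrow> real q \<le> C"
  shows "log 2 (order G) \<le> N * log 2 C"
proof -
  obtain n r p e where pd: "primary_decomposition G n r p e"
    and N: "real (\<Sum>i=1..n. \<Sum>j=1..r i. e i j) \<le> N"
    using S by (auto simp: in_S_def)
  have le: "real (p i) \<le> C" if "i \<in> {1..n}" for i
    using C(2) that primary_decomposition_prime_factors[OF pd] by auto
  have "real (order G) \<le> (\<Prod>i=1..n. \<Prod>j=1..r i. C ^ e i j)"
    unfolding primary_decomposition_order[OF pd] of_nat_prod of_nat_power
    using le by (intro prod_mono conjI power_mono prod_nonneg) auto
  also have "\<dots> = C ^ (\<Sum>i=1..n. \<Sum>j=1..r i. e i j)"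
    by (simp add: power_sum)
  finally have le: "real (order G) \<le> C ^ (\<Sum>i=1..n. \<Sum>j=1..r i. e i j)" .
  have "order G > 0"
    using pd by (auto simp: primary_decomposition_def comm_group_def group.is_monoid
        monoid.order_gt_0_iff_finite)
  then have "log 2 (order G) \<le> log 2 (C ^ (\<Sum>i=1..n. \<Sum>j=1..r i. e i j))"
    using le C(1) by simp
  also have "\<dots> = real (\<Sum>i=1..n. \<Sum>j=1..r i. e i j) * log 2 C"
    using C(1) by (simp add: log_nat_power del: of_nat_sum)
  also have "\<dots> \<le> N * log 2 C"
    using N C(1) by (intro mult_right_mono) auto
  finally show ?thesis .
qed

text \<open>If a prime other than \<open>p 1\<close> divides the order of \<open>x\<close>, it is at
  least \<open>p 2\<close>, which exceeds \<open>p 1 ^ 2\<close>. Otherwise the order is a power of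
  \<open>p 1\<close>, with exponent at least 2 because \<open>x\<close> is not killed by
  \<open>p 1\<close>.\<close>

lemma ord_ge_prime_square:
  assumes pd: "primary_decomposition G n r p e" and n: "1 \<le> n"
    and mono: "strict_mono_on {1..n} p" and gap: "n > 1 \<longrightarrow> p 1 ^ 2 < p 2"
    and x: "x \<in> carrier G" "x \<notin> torsion_part G (p 1)"
  shows "p 1 ^ 2 \<le> group.ord G x"
proof -
  interpret comm_group G using pd by (simp add: primary_decomposition_def)
  have fin: "finite (carrier G)" using pd by (simp add: primary_decomposition_def)
  have pr: "prime (p 1)" using pd n by (auto simp: primary_decomposition_def)
  define d where "d = ord x"
  have nd: "\<not> d dvd p 1" using x pow_eq_id by (auto simp: torsion_part_def d_def)
  have d0: "d > 0" using ord_ge_1[OF fin x(1)] by (simp add: d_def)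
  show ?thesis
  proof (cases "\<exists>q. prime q \<and> q dvd d \<and> q \<noteq> p 1")
    case True
    then obtain q where q: "prime q" "q dvd d" "q \<noteq> p 1" by blast
    have "q dvd order G" using q ord_dvd_group_order[OF x(1)] dvd_trans by (auto simp: d_def)
    then have "q \<in> prime_factors (order G)"
      using q fin order_gt_0_iff_finite by (auto simp: prime_factors_dvd)
    then obtain i where i: "i \<in> {1..n}" "q = p i"
      using primary_decomposition_prime_factors[OF pd] by auto
    then have "i \<noteq> 1" using q by auto
    then have i2: "2 \<le> i" "n > 1" using i by auto
    have "p 2 \<le> p i"
      using strict_mono_on_leD[OF mono, of 2 i] i i2 by auto
    then have "p 1 ^ 2 < q" using gap i2 i by auto
    also have "q \<le> d" using q d0 by (simp add: dvd_imp_le)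
    finally show ?thesis by (simp add: d_def)
  next
    case False
    then have "prime_factors d \<subseteq> {p 1}" by (auto simp: prime_factors_dvd)
    moreover have "d = (\<Prod>q\<in>prime_factors d. q ^ multiplicity q d)"
      using prod_prime_factors[of d] d0 by simp
    moreover have "d \<noteq> 1" using nd by auto
    ultimately obtain k where k: "d = p 1 ^ k"
      by (auto simp: subset_singleton_iff)
    have "\<not> k \<le> 1" using nd k by (cases k) auto
    then show ?thesis
      using k pr prime_gt_1_nat[OF pr] by (auto simp flip: d_def intro: power_increasing)
  qed
qed

section \<open>Assembly of the bound for UFIMs\<close>

lemma cross_number_le_K1_star:
  fixes c N :: real
  assumes pd: "primary_decomposition G n r p e" and n: "1 \<le> n"
    and mono: "strict_mono_on {1..n} p"
    and c: "1 \<le> c" and Om: "in_Omega c G" and S: "in_S N G"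
    and k: "group_cross_number G = k_star n r p e"
    and gap: "n > 1 \<longrightarrow> p 1 ^ 2 < p 2"
    and large: "log 2 (c * real (p 1)) / real (p 1) * N \<le> 1 / c * K1_star n r p e"
    and U: "UFIM G l g" and P: "irreducible_factorization G l g P"
    and out: "\<forall>I\<in>P. \<exists>i\<in>I. g i \<notin> torsion_part G (p 1)"
  shows "cross_number G g {1..l} \<le> K1_star n r p e"
proof -
  interpret comm_group G using pd by (simp add: primary_decomposition_def)
  have fin: "finite (carrier G)" using pd by (simp add: primary_decomposition_def)
  have p1: "prime (p 1)" using pd n by (auto simp: primary_decomposition_def)
  then have p1_gt: "1 < real (p 1)" using prime_gt_1_nat by simp
  \<comment> \<open>By \<open>in_Omega\<close> this bounds every prime divisor of the order, since
    the smallest one is at most \<open>p 1\<close>.\<close>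
  define C where "C = c * real (p 1)"
  have C: "1 < C" using c p1_gt mult_mono[of 1 c 1 "real (p 1)"] less_1_mult[of c "real (p 1)"]
    unfolding C_def by (cases "c = 1") auto
  have pf: "prime_factors (order G) = p ` {1..n}"
    by (rule primary_decomposition_prime_factors[OF pd])
  have p_le: "real q \<le> C" if "q \<in> prime_factors (order G)" for q
  proof -
    have "real q \<le> real (P_plus (order G))"
      using that unfolding P_plus_def by (intro of_nat_mono Max_ge) auto
    also have "\<dots> \<le> c * real (P_minus (order G))" using Om by (simp add: in_Omega_def)
    also have "\<dots> \<le> C" unfolding C_def P_minus_def
      using c n pf by (intro mult_left_mono of_nat_mono Min_le) auto
    finally show ?thesis .
  qed
  have "2 ^ card P \<le> order G" by (rule UFIM_two_power_card_le_order[OF fin U P])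
  then have "real (2 ^ card P) \<le> real (order G)" by (rule of_nat_mono)
  then have "log 2 (2 ^ card P) \<le> log 2 (order G)" by (intro log_mono) auto
  also have "\<dots> \<le> N * log 2 C" by (rule log_order_le[OF S C p_le])
  finally have card: "real (card P) \<le> N * log 2 C" by (simp add: log_nat_power)
  have "\<exists>i\<in>I. p 1 ^ 2 \<le> ord (g i)" if I: "I \<in> P" for I
  proof -
    obtain i where i: "i \<in> I" "g i \<notin> torsion_part G (p 1)" using out I by blast
    have "i \<in> {1..l}"
      using i I P by (auto simp: irreducible_factorization_def partition_on_def)
    then have "g i \<in> carrier G" using U by (auto simp: UFIM_def indexed_multiset_over_def)
    then show ?thesis using ord_ge_prime_square[OF pd n mono gap] i by blast
  qed
  then have "cross_number G g {1..l} \<le> group_cross_number G + real (card P) / real (p 1 ^ 2)"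
    using p1_gt by (intro UFIM_cross_number_le fin U P) auto
  also have "real (card P) / real (p 1 ^ 2) \<le> N * log 2 C / real (p 1 ^ 2)"
    using card by (intro divide_right_mono) auto
  \<comment> \<open>One factor \<open>p 1\<close> of the denominator goes into the hypothesis
    \<open>large\<close>; the other turns \<open>1 / c\<close> into \<open>1 / C\<close>, the form
    that \<open>K1_star_gap\<close> absorbs.\<close>
  also have "\<dots> = (log 2 C / real (p 1) * N) / real (p 1)"
    by (simp add: power2_eq_square mult.commute)
  also have "\<dots> \<le> (1 / c * K1_star n r p e) / real (p 1)"
    using large unfolding C_def by (intro divide_right_mono) auto
  also have "\<dots> = K1_star n r p e / C" by (simp add: C_def)
  also have "group_cross_number G + K1_star n r p e / C \<le> K1_star n r p e"
    unfolding k
  proof (rule K1_star_gap)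
    show "1 < p i \<and> real (p i) \<le> C" if "i \<in> {1..n}" for i
      using pd that p_le pf prime_gt_1_nat by (auto simp: primary_decomposition_def)
    show "1 \<le> e i j" if "i \<in> {1..n}" "j \<in> {1..r i}" for i j
      using pd that by (auto simp: primary_decomposition_def)
  qed
  finally show ?thesis by simp
qed

theorem corollary34:
  fixes G :: "('a, 'b) monoid_scheme"
    and n :: nat and r p :: "nat \<Rightarrow> nat" and e :: "nat \<Rightarrow> nat \<Rightarrow> nat"
  assumes "primary_decomposition G n r p e"
    and "1 \<le> n"
    and "strict_mono_on {1..n} p"
  shows
    "(\<forall>c N :: real.
        1 \<le> c \<longrightarrow> 1 \<le> N \<longrightarrow>
        in_Omega c G \<longrightarrow> in_S N G \<longrightarrow>
        group_cross_number G = k_star n r p e \<longrightarrow>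
        (n > 1 \<longrightarrow> p 1 ^ 2 < p 2) \<longrightarrow>
        Max {e 1 j | j. j \<in> {1..r 1}} > 1 \<longrightarrow>
        log 2 (c * real (p 1)) / real (p 1) * N \<le> 1 / c * K1_star n r p e \<longrightarrow>
        (\<forall>l g P. UFIM G l g \<longrightarrow> irreducible_factorization G l g P \<longrightarrow>
           (\<forall>I\<in>P. \<exists>i\<in>I. g i \<notin> torsion_part G (p 1)) \<longrightarrow>
           cross_number G g {1..l} \<le> K1_star n r p e))
     \<and>
     (n = 1 \<longrightarrow>
        group_cross_number G = k_star n r p e \<and>
        in_Omega 1 G \<and>
        (\<forall>N :: real.
           1 \<le> N \<longrightarrow> in_S N G \<longrightarrow>
           Max {e 1 j | j. j \<in> {1..r 1}} > 1 \<longrightarrow>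
           log 2 (real (p 1)) / real (p 1) * N \<le> K1_star n r p e \<longrightarrow>
           (\<forall>l g P. UFIM G l g \<longrightarrow> irreducible_factorization G l g P \<longrightarrow>
              (\<forall>I\<in>P. \<exists>i\<in>I. g i \<notin> torsion_part G (p 1)) \<longrightarrow>
              cross_number G g {1..l} \<le> K1_star n r p e)))"
proof (intro conjI allI impI)
  fix c N :: real and l g P
  assume "1 \<le> c" "in_Omega c G" "in_S N G" "group_cross_number G = k_star n r p e"
    "n > 1 \<longrightarrow> p 1 ^ 2 < p 2"
    "log 2 (c * real (p 1)) / real (p 1) * N \<le> 1 / c * K1_star n r p e"
    "UFIM G l g" "irreducible_factorization G l g P"
    "\<forall>I\<in>P. \<exists>i\<in>I. g i \<notin> torsion_part G (p 1)"
  then show "cross_number G g {1..l} \<le> K1_star n r p e"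
    by (rule cross_number_le_K1_star[OF assms])
next
  assume n: "n = 1"
  then show k: "group_cross_number G = k_star n r p e"
    using group_cross_number_single_prime assms(1) by blast
  have "prime_factors (order G) = {p 1}"
    using primary_decomposition_prime_factors[OF assms(1)] n by simp
  then show Om: "in_Omega 1 G"
    using assms(1) by (simp add: in_Omega_def P_plus_def P_minus_def primary_decomposition_def)
  fix N :: real and l g P
  assume "in_S N G" "log 2 (real (p 1)) / real (p 1) * N \<le> K1_star n r p e"
    "UFIM G l g" "irreducible_factorization G l g P"
    "\<forall>I\<in>P. \<exists>i\<in>I. g i \<notin> torsion_part G (p 1)"
  \<comment> \<open>The general bound is instantiated at \<open>c = 1\<close>, where its largeness
    condition becomes the given one.\<close>
  then show "cross_number G g {1..l} \<le> K1_star n r p e"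
    using n by (intro cross_number_le_K1_star[OF assms order_refl Om _ k]) auto
qed

end
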